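(* A connected graph is $0$-stress regular if and only if it is a complete graph.
   Context: Graphs are finite, undirected and simple. A geodesic is a shortest path between two vertices (a path and its reverse are the same geodesic); it passes through a vertex $v$ if $v$ is an internal vertex of it. The stress $\mathrm{str}(v)$ of a vertex $v$ is the number of geodesics in the graph passing through $v$. A graph is $k$-stress regular if all of its vertices have stress $k$. *)

theory Defs
  imports "Graph_Theory.Graph_Theory"
begin

text \<open>Finite simple undirected graphs are modelled by the locale \<^locale>\<open>graph\<close>: finite,
  loop-free, without parallel arcs, and with a symmetric adjacency relation
  \<^term>\<open>arcs_ends G\<close>. Since such a graph is simple, its paths are determined by
  their vertex sequences and are represented by \<^const>\<open>vpath\<close>.\<close>

definition geodesic :: "('a, 'b) pre_digraph \<Rightarrow> 'a vwalk \<Rightarrow> bool" where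
  "geodesic G p \<longleftrightarrow> vpath p G \<and>
     (\<forall>q. vpath q G \<and> hd q = hd p \<and> last q = last p \<longrightarrow> vwalk_length p \<le> vwalk_length q)"

definition internal_verts :: "'a vwalk \<Rightarrow> 'a set" where
  "internal_verts p = set (butlast (tl p))"

text \<open>A path and its reverse are the same geodesic, so the sets \<open>{p, rev p}\<close> are counted.\<close>

definition geodesics_through :: "('a, 'b) pre_digraph \<Rightarrow> 'a \<Rightarrow> 'a vwalk set set" where
  "geodesics_through G v = {{p, rev p} | p. geodesic G p \<and> v \<in> internal_verts p}"

definition stress :: "('a, 'b) pre_digraph \<Rightarrow> 'a \<Rightarrow> nat" where
  "stress G v = card (geodesics_through G v)"

definition stress_regular :: "nat \<Rightarrow> ('a, 'b) pre_digraph \<Rightarrow> bool" where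
  "stress_regular k G \<longleftrightarrow> (\<forall>v \<in> verts G. stress G v = k)"

text \<open>The set counted by \<^const>\<open>stress\<close> is finite, so \<^const>\<open>card\<close> is its true cardinality.\<close>

lemma finite_geodesics_through:
  assumes "graph G"
  shows "finite (geodesics_through G v)"
proof -
  interpret graph G by fact
  have "{p. geodesic G p} \<subseteq> {p. set p \<subseteq> verts G \<and> distinct p}"
    by (auto simp: geodesic_def vpath_def vwalk_def)
  then have "finite {p. geodesic G p}"
    using finite_subset_distinct[OF finite_verts] finite_subset by blast
  then have "finite ((\<lambda>p. {p, rev p}) ` {p. geodesic G p})"
    by simp
  then show ?thesis
    by (rule rev_finite_subset) (auto simp: geodesics_through_def)
qed

end

theory Submission
  imports Defs
begin

text \<open>
  Stress $0$ everywhere says that no geodesic has an internal vertex, that is, every geodesic has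
  at most two vertices (\<open>stress_regular_0_iff\<close>). In a connected graph any two
  distinct vertices are joined by a geodesic (\<open>geodesic_exists\<close>), and a geodesic
  with exactly two vertices is an edge; so stress $0$ forces all distinct vertices to be adjacent.
  Conversely, an edge between the ends of a geodesic is itself a competing path of length one, so
  in a complete graph the geodesics are the single vertices and the edges.
\<close>

lemma geodesic_exists:
  assumes "wf_digraph G" and "u \<rightarrow>\<^sup>*\<^bsub>G\<^esub> v"
  obtains p where "geodesic G p" "hd p = u" "last p = v"
proof -
  let ?path = "\<lambda>p. vpath p G \<and> hd p = u \<and> last p = v"
  interpret wf_digraph G by fact
  from assms(2) obtain p where "?path p"
    unfolding reachable_vpath_conv by blast
  then obtain q where "?path q" "\<forall>r. ?path r \<longrightarrow> vwalk_length q \<le> vwalk_length r"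
    using ex_has_least_nat[of ?path p vwalk_length] by blast
  then show thesis
    using that[of q] unfolding geodesic_def by blast
qed

lemma internal_verts_empty_iff: "internal_verts p = {} \<longleftrightarrow> length p \<le> 2"
proof -
  have "internal_verts p = {} \<longleftrightarrow> length (butlast (tl p)) = 0"
    unfolding internal_verts_def length_0_conv set_empty ..
  also have "\<dots> \<longleftrightarrow> length p \<le> 2"
    unfolding length_butlast length_tl by arith
  finally show ?thesis .
qed

text \<open>Finiteness of the family of geodesics matters here: only then does cardinality $0$ mean that
  the family is empty.\<close>

lemma stress_regular_0_iff:
  assumes "graph G"
  shows "stress_regular 0 G \<longleftrightarrow> (\<forall>p. geodesic G p \<longrightarrow> length p \<le> 2)"
proof -
  have "stress G v = 0 \<longleftrightarrow> (\<forall>p. geodesic G p \<longrightarrow> v \<notin> internal_verts p)" for v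
    using finite_geodesics_through[OF assms, of v]
    by (auto simp: stress_def geodesics_through_def)
  moreover have "internal_verts p \<subseteq> verts G" if "geodesic G p" for p
    using that unfolding geodesic_def vpath_def vwalk_def internal_verts_def
    by (meson in_set_butlastD list.set_sel(2) subset_iff tl_Nil)
  ultimately have "stress_regular 0 G \<longleftrightarrow> (\<forall>p. geodesic G p \<longrightarrow> internal_verts p = {})"
    unfolding stress_regular_def by blast
  then show ?thesis
    unfolding internal_verts_empty_iff .
qed

lemma short_geodesic_imp_adjacent:
  assumes "geodesic G p" and "length p \<le> 2" and "hd p \<noteq> last p"
  shows "hd p \<rightarrow>\<^bsub>G\<^esub> last p"
proof -
  from assms(1) have "p \<noteq> []"
    by (auto simp: geodesic_def vpath_def vwalk_def)
  with assms(2,3) obtain u v where "p = [u, v]"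
    by (cases p rule: remdups_adj.cases) auto
  with assms(1) show ?thesis
    by (simp add: geodesic_def vpath_def vwalk_def)
qed

text \<open>The competitor that bounds the length is the one-vertex path if the ends coincide, and the
  edge between them otherwise.\<close>

lemma geodesic_length_le_2:
  assumes "wf_digraph G" and "geodesic G p" and "hd p = last p \<or> hd p \<rightarrow>\<^bsub>G\<^esub> last p"
  shows "length p \<le> 2"
proof (cases "hd p = last p")
  case True
  from assms(2) have "hd p \<in> verts G"
    by (auto simp: geodesic_def vpath_def vwalk_def)
  then have "vpath [hd p] G"
    by (rule vpath_self)
  with assms(2) True have "vwalk_length p \<le> vwalk_length [hd p]"
    unfolding geodesic_def by (metis last.simps list.sel(1))
  then show ?thesis
    by simp
next
  case False
  with assms(3) have adj: "hd p \<rightarrow>\<^bsub>G\<^esub> last p"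
    by blast
  interpret wf_digraph G by fact
  from adj False have "vpath [hd p, last p] G"
    by (auto simp: vpath_def dest: adj_in_verts)
  with assms(2) have "vwalk_length p \<le> vwalk_length [hd p, last p]"
    unfolding geodesic_def by (metis last.simps list.sel(1) list.distinct(1))
  then show ?thesis
    by simp
qed

theorem corollary2p5:
  fixes G :: "('a, 'b) pre_digraph"
  assumes "graph G" and "connected G"
  shows "stress_regular 0 G \<longleftrightarrow> (\<exists>n. complete_digraph n G)"
proof -
  interpret graph G by fact
  have "stress_regular 0 G \<longleftrightarrow> (\<forall>u\<in>verts G. \<forall>v\<in>verts G. u \<noteq> v \<longrightarrow> u \<rightarrow>\<^bsub>G\<^esub> v)"
  proof (intro iffI ballI impI)
    fix u v
    assume "stress_regular 0 G" and uv: "u \<in> verts G" "v \<in> verts G" "u \<noteq> v"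
    have "strongly_connected G"
      using sym_arcs assms(2) by (rule symmetric_connected_imp_strongly_connected)
    with uv have "u \<rightarrow>\<^sup>*\<^bsub>G\<^esub> v"
      unfolding strongly_connected_def by simp
    then obtain p where p: "geodesic G p" "hd p = u" "last p = v"
      by (rule geodesic_exists[OF wf_digraph])
    with \<open>stress_regular 0 G\<close> have "length p \<le> 2"
      using stress_regular_0_iff[OF assms(1)] by blast
    with p uv show "u \<rightarrow>\<^bsub>G\<^esub> v"
      using short_geodesic_imp_adjacent by blast
  next
    assume adj: "\<forall>u\<in>verts G. \<forall>v\<in>verts G. u \<noteq> v \<longrightarrow> u \<rightarrow>\<^bsub>G\<^esub> v"
    have "length p \<le> 2" if "geodesic G p" for p
    proof -
      from that have "hd p \<in> verts G" "last p \<in> verts G"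
        by (auto simp: geodesic_def vpath_def vwalk_def)
      with adj have "hd p = last p \<or> hd p \<rightarrow>\<^bsub>G\<^esub> last p"
        by blast
      with wf_digraph that show ?thesis
        by (rule geodesic_length_le_2)
    qed
    then show "stress_regular 0 G"
      using stress_regular_0_iff[OF assms(1)] by blast
  qed
  also have "\<dots> \<longleftrightarrow> arcs_ends G = {(u, v). (u, v) \<in> verts G \<times> verts G \<and> u \<noteq> v}"
    by (auto dest: adj_in_verts adj_not_same)
  also have "\<dots> \<longleftrightarrow> (\<exists>n. complete_digraph n G)"
    using assms(1) unfolding complete_digraph_def by blast
  finally show ?thesis .
qed

end
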